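(* Let $P>0$ be fixed and let $\Theta=\Theta(K)$ be a threshold satisfying, as $K\to\infty$, $$\Theta\ \ge\ \log K-o(\log K)\qquad\text{and}\qquad \Theta\ \le\ \log K-\log\log K-\omega(1),$$ i.e. $\Theta\geq \log K-a(K)$ with $a(K)/\log K\to0$, and $\log K-\log\log K-\Theta\to\infty$. Let $\overline{\mathcal T}_3=\overline{\mathcal T}_3(K)$ be the throughput, with $K$ users, of Strategy III with threshold $\Theta$ (scheduling based on both SNR and channel correlation, with adaptive codeword length), as defined in the context. Then, as $K\to\infty$, $$\overline{\mathcal T}_3\ \ge\ \log(P\log K)-o(1).$$
   Context: **Channel.** There are $K$ users. User $k$ has a correlation coefficient $\alpha_k$ and an initial fading gain $u_{0,k}$; the $\alpha_k$ are i.i.d. uniform on $(0,1)$, the $u_{0,k}$ are i.i.d. with Rayleigh density $2ue^{-u^2}$, $u\ge0$, and the two families are independent. For a user with parameters $(u_0,\alpha)$, conditioned on these, the gains $u_1,u_2,\dots$ form a Markov chain started at $u_0$ with transition density, for $u\ge 0$, $$q(u\mid v)=\frac{2u}{1-\alpha^2}\exp\left(-\frac{u^2+\alpha^2v^2}{1-\alpha^2}\right)\mathcal{I}_0\left(\frac{2\alpha uv}{1-\alpha^2}\right),$$ with $\mathcal I_0$ the modified Bessel function of order zero. **Throughput of one user.** For codeword length $N$ and $\rho\in[0,1]$ let $$E_N(\rho;u_0,\alpha)=-\frac1N\log\mathbb{E}\left\{\prod_{i=1}^N\left(\frac{1}{1+\frac{P}{1+\rho}u_i^2}\right)^{\rho}\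 \Big|\ u_0,\alpha\right\}$$ (random coding error exponent). For rate $R\ge0$ (nats per channel use) the throughput, with the frame error probability evaluated by its random coding upper bound, is $$T(u_0,\alpha;N,R)=R\left(1-\inf_{0\le\rho\le1}e^{-N(E_N(\rho;u_0,\alpha)-\rho R)}\right).$$ **Strategy III.** Only users with initial gain at least $\sqrt{\Theta}$ report to the base station: $\mathcal S=\{k: u_{0,k}^2\ge\Theta\}$. Among these the base station selects the user $k^\dagger=\arg\max_{k\in\mathcal S}\alpha_k$ with the largest correlation coefficient; the rate and codeword length are then chosen to maximize that user's throughput. If $\mathcal S=\emptyset$ there is no transmission and the throughput is $0$. Thus $$\overline{\mathcal T}_3(K)=\mathbb{E}\left\{\mathbf 1_{\{\mathcal S\ne\emptyset\}}\sup_{N\ge1,\ R\ge0}T(u_{0,k^\dagger},\alpha_{k^\dagger};N,R)\right\}.$$ $\log$ is the natural logarithm; $f=\omega(1)$ means $f\to\infty$ and $f=o(g)$ means $f/g\to0$. *)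

theory Defs
  imports "HOL-Probability.Probability" "HOL-Library.Landau_Symbols"
begin

definition bessel_I0 :: "real \<Rightarrow> real" where
  "bessel_I0 x = (\<Sum>m. (x / 2) ^ (2 * m) / (fact m)\<^sup>2)"

definition rayleigh_density :: "real \<Rightarrow> real" where
  "rayleigh_density u = (if 0 \<le> u then 2 * u * exp (- u\<^sup>2) else 0)"

definition gain_transition :: "real \<Rightarrow> real \<Rightarrow> real \<Rightarrow> real" where
  "gain_transition \<alpha> v u =
    (if 0 \<le> u
     then 2 * u / (1 - \<alpha>\<^sup>2) * exp (- (u\<^sup>2 + \<alpha>\<^sup>2 * v\<^sup>2) / (1 - \<alpha>\<^sup>2))
          * bessel_I0 (2 * \<alpha> * u * v / (1 - \<alpha>\<^sup>2))
     else 0)"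

(* The joint conditional law of the gains (u 1, ..., u N) given u0 and \<alpha>:
   the Markov chain started at u0 has joint density
   q(u 1 | u0) * q(u 2 | u 1) * ... * q(u N | u (N - 1)). *)
definition gain_law :: "real \<Rightarrow> real \<Rightarrow> nat \<Rightarrow> (nat \<Rightarrow> real) measure" where
  "gain_law u0 \<alpha> N =
    density (\<Pi>\<^sub>M i\<in>{1..N}. lborel)
      (\<lambda>u. ennreal (\<Prod>i\<in>{1..N}.
         gain_transition \<alpha> (if i = 1 then u0 else u (i - 1)) (u i)))"

definition error_exponent :: "real \<Rightarrow> nat \<Rightarrow> real \<Rightarrow> real \<Rightarrow> real \<Rightarrow> real" where
  "error_exponent P N \<rho> u0 \<alpha> =
    - (1 / real N) *
      ln (\<integral>u. (\<Prod>i\<in>{1..N}. (1 / (1 + P / (1 + \<rho>) * (u i)\<^sup>2)) powr \<rho>) \<partial>gain_law u0 \<alpha> N)"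

definition user_throughput :: "real \<Rightarrow> real \<Rightarrow> real \<Rightarrow> nat \<Rightarrow> real \<Rightarrow> real" where
  "user_throughput P u0 \<alpha> N R =
    R * (1 - (INF \<rho>\<in>{0..1}. exp (- real N * (error_exponent P N \<rho> u0 \<alpha> - \<rho> * R))))"

definition reporting_users :: "(nat \<Rightarrow> 'a \<Rightarrow> real) \<Rightarrow> real \<Rightarrow> nat \<Rightarrow> 'a \<Rightarrow> nat set" where
  "reporting_users U \<theta> K \<omega> = {k. k < K \<and> \<theta> \<le> (U k \<omega>)\<^sup>2}"

definition selected_user ::
  "(nat \<Rightarrow> 'a \<Rightarrow> real) \<Rightarrow> (nat \<Rightarrow> 'a \<Rightarrow> real) \<Rightarrow> real \<Rightarrow> nat \<Rightarrow> 'a \<Rightarrow> nat" where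
  "selected_user U A \<theta> K \<omega> = arg_max_on (\<lambda>k. A k \<omega>) (reporting_users U \<theta> K \<omega>)"

(* The user throughput is nonnegative for R \<ge> 0 (its infimum is at most the value 1
   taken at \<rho> = 0), so no mass is lost by taking supremum and expectation in the
   extended nonnegative reals. *)
definition throughput3 ::
  "real \<Rightarrow> 'a measure \<Rightarrow> (nat \<Rightarrow> 'a \<Rightarrow> real) \<Rightarrow> (nat \<Rightarrow> 'a \<Rightarrow> real) \<Rightarrow> real \<Rightarrow> nat \<Rightarrow> ennreal" where
  "throughput3 P M U A \<theta> K =
    (\<integral>\<^sup>+\<omega>. indicator {\<omega>. reporting_users U \<theta> K \<omega> \<noteq> {}} \<omega> *
       (SUP N\<in>{1..}. SUP R\<in>{0..}.
          ennreal (user_throughput P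
            (U (selected_user U A \<theta> K \<omega>) \<omega>) (A (selected_user U A \<theta> K \<omega>) \<omega>) N R)) \<partial>M)"

end

theory Submission
  imports Defs "HOL-Real_Asymp.Real_Asymp"
begin

text \<open>Put \<open>L = ln K\<close>. On average \<open>K exp (- \<Theta>) \<ge> L\<close> users report, so with probability at least
  \<open>1 - exp (- sqrt L)\<close> one of them, hence the selected one, has \<open>\<alpha> > 1 - 1 / sqrt L\<close>. For such a user the
  gain hardly moves during a codeword of length about \<open>ln L\<close>. The Laplace transform of the transition
  density is \<open>exp (- t \<alpha>\<^sup>2 v\<^sup>2 / (1 + t \<sigma>)) / (1 + t \<sigma>)\<close> with \<open>\<sigma> = 1 - \<alpha>\<^sup>2\<close>; iterated along the chain it gives
  a Chernoff bound showing that \<open>u\<^sup>2\<close> drops below \<open>(1 - \<delta>) L\<close> only with a probability exponentially small in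
  \<open>L\<close>. This beats the factor \<open>exp (N \<rho> R)\<close>, which is \<open>exp (O ((ln L)\<^sup>2))\<close>, in the random coding bound.\<close>

subsection \<open>Laplace transform of the transition density\<close>

text \<open>Since \<open>fact m \<ge> 1\<close>, the series is dominated by the exponential series
  of \<open>(x / 2)\<^sup>2\<close>. Convergence is what allows the Bessel factor to be integrated
  term by term.\<close>

lemma bessel_I0_sums:
  "(\<lambda>m. (x / 2) ^ (2 * m) / (fact m)\<^sup>2) sums bessel_I0 x"
proof -
  have "summable (\<lambda>m. (x / 2) ^ (2 * m) / (fact m)\<^sup>2)"
  proof (rule summable_comparison_test')
    show "summable (\<lambda>m. ((x / 2)\<^sup>2) ^ m / fact m)"
      using summable_exp[of "(x / 2)\<^sup>2"] by (simp only: divide_inverse mult.commute)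
    fix m :: nat
    have "(fact m :: real) \<le> (fact m)\<^sup>2"
      by (rule self_le_power) (simp_all add: fact_ge_1)
    hence "((x / 2)\<^sup>2) ^ m / (fact m)\<^sup>2 \<le> ((x / 2)\<^sup>2) ^ m / fact m"
      by (rule frac_le[OF zero_le_power[OF zero_le_power2] order_refl fact_gt_zero])
    moreover have "norm ((x / 2) ^ (2 * m) / (fact m)\<^sup>2) = ((x / 2)\<^sup>2) ^ m / (fact m)\<^sup>2"
      unfolding power_mult real_norm_def
      by (intro abs_of_nonneg divide_nonneg_nonneg zero_le_power zero_le_power2)
    ultimately show "norm ((x / 2) ^ (2 * m) / (fact m)\<^sup>2) \<le> ((x / 2)\<^sup>2) ^ m / fact m"
      by simp
  qed
  thus ?thesis
    unfolding bessel_I0_def by (rule summable_sums)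
qed

lemma bessel_I0_nonneg: "0 \<le> bessel_I0 x"
  by (rule sums_le[OF _ sums_zero bessel_I0_sums]) (simp add: power_mult)

lemma gain_transition_nonneg:
  assumes "\<alpha>\<^sup>2 < 1"
  shows "0 \<le> gain_transition \<alpha> v u"
  using assms bessel_I0_nonneg by (simp add: gain_transition_def)

lemma measurable_bessel_I0 [measurable]: "bessel_I0 \<in> borel_measurable borel"
  unfolding bessel_I0_def [abs_def] by measurable

lemma measurable_gain_transition [measurable]:
  assumes [measurable]: "f \<in> borel_measurable M" "g \<in> borel_measurable M"
  shows "(\<lambda>x. gain_transition \<alpha> (f x) (g x)) \<in> borel_measurable M"
  unfolding gain_transition_def by measurable

text \<open>The substitution \<open>x = sqrt c * u\<close> reduces the integral to the standard odd
  Gaussian moment, the case \<open>c = 1\<close>.\<close>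

lemma nn_integral_odd_gaussian_moment:
  fixes c :: real
  assumes "0 < c"
  shows "(\<integral>\<^sup>+u. ennreal (indicator {0..} u * (u ^ (2 * m + 1) * exp (- c * u\<^sup>2))) \<partial>lborel)
    = ennreal (fact m / (2 * c ^ (m + 1)))"
proof -
  define f :: "real \<Rightarrow> real" where
    "f x = indicator {0..} x * (x ^ (2 * m + 1) * exp (- x\<^sup>2))" for x
  define s where "s = sqrt c"
  have s: "0 < s" "s\<^sup>2 = c" using assms by (auto simp: s_def)
  have [measurable]: "f \<in> borel_measurable borel" unfolding f_def by measurable
  have nn: "0 \<le> f x" for x by (auto simp: f_def indicator_def)
  have "has_bochner_integral lborel f (fact m / 2)"
    using gaussian_moment_odd_pos[of m]
    by (simp add: f_def [abs_def] mult_ac)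
  hence "ennreal (fact m / 2) = (\<integral>\<^sup>+x. ennreal (f x) \<partial>lborel)"
    using nn by (subst nn_integral_eq_integral) (auto simp: has_bochner_integral_iff)
  also have "\<dots> = ennreal s * (\<integral>\<^sup>+u. ennreal (f (s * u)) \<partial>lborel)"
    using s nn_integral_real_affine[of "\<lambda>x. ennreal (f x)" s 0] by simp
  also have "(\<lambda>u. f (s * u)) = (\<lambda>u. s ^ (2 * m + 1) *
      (indicator {0..} u * (u ^ (2 * m + 1) * exp (- c * u\<^sup>2))))"
    using s by (auto simp: f_def indicator_def power_mult_distrib zero_le_mult_iff)
  also have "(\<integral>\<^sup>+u. ennreal (s ^ (2 * m + 1) *
      (indicator {0..} u * (u ^ (2 * m + 1) * exp (- c * u\<^sup>2)))) \<partial>lborel) =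
      ennreal (s ^ (2 * m + 1)) *
      (\<integral>\<^sup>+u. ennreal (indicator {0..} u * (u ^ (2 * m + 1) * exp (- c * u\<^sup>2))) \<partial>lborel)"
    (is "_ = _ * ?I")
    using s by (subst nn_integral_cmult[symmetric]) (auto simp: ennreal_mult'[symmetric])
  also have "ennreal s * (ennreal (s ^ (2 * m + 1)) * ?I) = ennreal (c ^ (m + 1)) * ?I"
  proof -
    have "s * s ^ (2 * m + 1) = (s\<^sup>2) ^ (m + 1)"
      unfolding power_mult [symmetric] by simp
    thus ?thesis
      using s by (simp add: mult.assoc[symmetric] ennreal_mult'[symmetric])
  qed
  finally have *: "ennreal (fact m / 2) = ennreal (c ^ (m + 1)) * ?I" .
  have "?I = ennreal (1 / c ^ (m + 1)) * (ennreal (c ^ (m + 1)) * ?I)"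
    using assms by (simp add: mult.assoc[symmetric] ennreal_mult'[symmetric])
  also have "\<dots> = ennreal (1 / c ^ (m + 1) * (fact m / 2))"
    unfolding *[symmetric] using assms by (intro ennreal_mult'[symmetric]) simp
  finally show ?thesis by (simp add: mult.commute)
qed

text \<open>Under this density \<open>u\<^sup>2\<close> is a scaled noncentral chi-square variable
  with two degrees of freedom. All terms of the Bessel series are nonnegative, so it may be
  integrated termwise; each Gaussian moment cancels one of the two factorials, which leaves an
  exponential series in \<open>z / c\<close>.\<close>

lemma gain_transition_laplace:
  fixes \<alpha> t v :: real
  assumes \<alpha>: "\<alpha>\<^sup>2 < 1" and t: "0 \<le> t"
  defines "\<sigma> \<equiv> 1 - \<alpha>\<^sup>2"
  shows "(\<integral>\<^sup>+u. ennreal (gain_transition \<alpha> v u) * ennreal (exp (- t * u\<^sup>2)) \<partial>lborel)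
    = ennreal (exp (- (t * \<alpha>\<^sup>2 * v\<^sup>2) / (1 + t * \<sigma>)) / (1 + t * \<sigma>))"
proof -
  have \<sigma>: "0 < \<sigma>" using \<alpha> by (simp add: \<sigma>_def)
  \<comment> \<open>The rate \<open>c\<close> merges the Gaussian factor of the density with the
    weight \<open>exp (- t * u\<^sup>2)\<close>. Below, \<open>d m\<close> collects what is constant
    in \<open>u\<close> in the term of index \<open>m\<close>, and \<open>w m\<close> is the moment
    integrand.\<close>
  define c where "c = 1 / \<sigma> + t"
  have c: "0 < c" using \<sigma> t by (simp add: c_def add_pos_nonneg)
  have c\<sigma>: "c * \<sigma> = 1 + t * \<sigma>" using \<sigma> by (simp add: c_def field_simps)
  define z where "z = (\<alpha> * v / \<sigma>)\<^sup>2"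
  have z: "0 \<le> z" by (simp add: z_def)
  define B where "B = 2 / \<sigma> * exp (- \<alpha>\<^sup>2 * v\<^sup>2 / \<sigma>)"
  have B: "0 \<le> B" using \<sigma> by (simp add: B_def)
  define w where "w m u = indicator {0..} u * (u ^ (2 * m + 1) * exp (- c * u\<^sup>2))" for m u
  have [measurable]: "w m \<in> borel_measurable borel" for m
    unfolding w_def by measurable
  have w: "0 \<le> w m u" for m u by (auto simp: w_def indicator_def)
  define d where "d m = B * z ^ m / (fact m)\<^sup>2" for m
  have d: "0 \<le> d m" for m using B z by (simp add: d_def)
  have 1: "ennreal (gain_transition \<alpha> v u) * ennreal (exp (- t * u\<^sup>2)) = (\<Sum>m. ennreal (d m * w m u))"
    for u
  proof (cases "0 \<le> u")
    case True
    have "(\<lambda>m. (2 * u / \<sigma> * exp (- (u\<^sup>2 + \<alpha>\<^sup>2 * v\<^sup>2) / \<sigma>) * exp (- t * u\<^sup>2)) *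
        ((2 * \<alpha> * u * v / \<sigma> / 2) ^ (2 * m) / (fact m)\<^sup>2)) sums
        ((2 * u / \<sigma> * exp (- (u\<^sup>2 + \<alpha>\<^sup>2 * v\<^sup>2) / \<sigma>) * exp (- t * u\<^sup>2)) *
        bessel_I0 (2 * \<alpha> * u * v / \<sigma>))"
      by (intro sums_mult bessel_I0_sums)
    also have "(\<lambda>m. (2 * u / \<sigma> * exp (- (u\<^sup>2 + \<alpha>\<^sup>2 * v\<^sup>2) / \<sigma>) * exp (- t * u\<^sup>2)) *
        ((2 * \<alpha> * u * v / \<sigma> / 2) ^ (2 * m) / (fact m)\<^sup>2)) = (\<lambda>m. d m * w m u)"
    proof
      fix m
      have e: "exp (- (u\<^sup>2 + \<alpha>\<^sup>2 * v\<^sup>2) / \<sigma>) * exp (- t * u\<^sup>2) =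
          exp (- \<alpha>\<^sup>2 * v\<^sup>2 / \<sigma>) * exp (- c * u\<^sup>2)"
        unfolding exp_add[symmetric] c_def using \<sigma> by (simp add: field_simps)
      have p: "(2 * \<alpha> * u * v / \<sigma> / 2) ^ (2 * m) = z ^ m * u ^ (2 * m)"
        by (simp add: z_def power_mult power_mult_distrib power_divide)
      show "(2 * u / \<sigma> * exp (- (u\<^sup>2 + \<alpha>\<^sup>2 * v\<^sup>2) / \<sigma>) * exp (- t * u\<^sup>2)) *
        ((2 * \<alpha> * u * v / \<sigma> / 2) ^ (2 * m) / (fact m)\<^sup>2) = d m * w m u"
        using True unfolding mult.assoc[of "2 * u / \<sigma>"] e p
        by (simp add: d_def w_def B_def)
    qed
    finally have "(\<lambda>m. d m * w m u) sums (gain_transition \<alpha> v u * exp (- t * u\<^sup>2))"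
      using True by (simp add: gain_transition_def \<sigma>_def mult_ac)
    from suminf_ennreal_eq[OF _ this] d w gain_transition_nonneg[OF \<alpha>]
    show ?thesis by (simp add: ennreal_mult)
  next
    case False
    thus ?thesis by (simp add: gain_transition_def w_def)
  qed
  have 2: "(\<integral>\<^sup>+u. ennreal (d m * w m u) \<partial>lborel) = ennreal (B / (2 * c) * (inverse (fact m) * (z / c) ^ m))"
    for m
  proof -
    have "(\<integral>\<^sup>+u. ennreal (d m * w m u) \<partial>lborel) = ennreal (d m) * (\<integral>\<^sup>+u. ennreal (w m u) \<partial>lborel)"
      unfolding ennreal_mult'[OF d] by (rule nn_integral_cmult) measurable
    also have "\<dots> = ennreal (d m * (fact m / (2 * c ^ (m + 1))))"
      unfolding w_def nn_integral_odd_gaussian_moment[OF c] by (rule ennreal_mult'[OF d, symmetric])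
    also have "d m * (fact m / (2 * c ^ (m + 1))) = B / (2 * c) * (inverse (fact m) * (z / c) ^ m)"
      unfolding d_def power2_eq_square power_divide by (simp add: divide_simps)
    finally show ?thesis .
  qed
  have "(\<integral>\<^sup>+u. ennreal (gain_transition \<alpha> v u) * ennreal (exp (- t * u\<^sup>2)) \<partial>lborel)
      = (\<Sum>m. ennreal (B / (2 * c) * (inverse (fact m) * (z / c) ^ m)))"
    unfolding 1 2[symmetric] by (rule nn_integral_suminf) measurable
  also have "\<dots> = ennreal (B / (2 * c) * exp (z / c))"
  proof (rule suminf_ennreal_eq)
    show "(\<lambda>m. B / (2 * c) * (inverse (fact m) * (z / c) ^ m)) sums (B / (2 * c) * exp (z / c))"
      using exp_converges[of "z / c"] by (intro sums_mult) simp
  qed (use B c z in simp)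
  also have "B / (2 * c) * exp (z / c) = exp (- (t * \<alpha>\<^sup>2 * v\<^sup>2) / (1 + t * \<sigma>)) / (1 + t * \<sigma>)"
  proof -
    have g: "1 + t * \<sigma> \<noteq> 0" using c \<sigma> c\<sigma> by auto
    have "z / c = \<alpha>\<^sup>2 * v\<^sup>2 / \<sigma> / (1 + t * \<sigma>)"
      using c \<sigma> unfolding c\<sigma>[symmetric] z_def by (simp add: power_mult_distrib power_divide power2_eq_square mult_ac)
    hence "- \<alpha>\<^sup>2 * v\<^sup>2 / \<sigma> + z / c = \<alpha>\<^sup>2 * v\<^sup>2 / \<sigma> * (1 / (1 + t * \<sigma>) - 1)"
      unfolding right_diff_distrib by simp
    also have "1 / (1 + t * \<sigma>) - 1 = - (t * \<sigma>) / (1 + t * \<sigma>)"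
      using g by (simp add: field_simps)
    also have "\<alpha>\<^sup>2 * v\<^sup>2 / \<sigma> * (- (t * \<sigma>) / (1 + t * \<sigma>)) = - (t * \<alpha>\<^sup>2 * v\<^sup>2) / (1 + t * \<sigma>)"
      using \<sigma> by simp
    finally have "exp (- \<alpha>\<^sup>2 * v\<^sup>2 / \<sigma>) * exp (z / c) = exp (- (t * \<alpha>\<^sup>2 * v\<^sup>2) / (1 + t * \<sigma>))"
      unfolding exp_add[symmetric] by simp
    thus ?thesis
      unfolding c\<sigma>[symmetric] B_def using c \<sigma> by (simp add: mult_ac)
  qed
  finally show ?thesis .
qed

lemma nn_integral_gain_transition:
  assumes "\<alpha>\<^sup>2 < 1"
  shows "(\<integral>\<^sup>+u. ennreal (gain_transition \<alpha> v u) \<partial>lborel) = 1"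
  using gain_transition_laplace[OF assms, of 0 v] by simp

text \<open>A weaker form that can be iterated: the shape \<open>exp (- t * u\<^sup>2)\<close> is
  preserved while \<open>t\<close> shrinks by \<open>\<alpha> ^ 4\<close>. One factor
  \<open>\<alpha>\<^sup>2\<close> is in the exact formula; the other bounds
  \<open>1 / (1 + t * \<sigma>)\<close> from below, because
  \<open>\<alpha>\<^sup>2 * (1 + \<sigma>) = 1 - \<sigma>\<^sup>2\<close>. The prefactor is at most
  1.\<close>

lemma gain_transition_laplace_le:
  fixes \<alpha> t v :: real
  assumes \<alpha>: "\<alpha>\<^sup>2 < 1" and t: "0 \<le> t" "t \<le> 1"
  shows "(\<integral>\<^sup>+u. ennreal (gain_transition \<alpha> v u) * ennreal (exp (- t * u\<^sup>2)) \<partial>lborel)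
    \<le> ennreal (exp (- (\<alpha> ^ 4 * t) * v\<^sup>2))"
proof -
  define \<sigma> where "\<sigma> = 1 - \<alpha>\<^sup>2"
  have \<sigma>: "0 < \<sigma>" using \<alpha> by (simp add: \<sigma>_def)
  have g: "1 \<le> 1 + t * \<sigma>" using \<sigma> t by simp
  have "t * \<sigma> \<le> \<sigma>" using \<sigma> t by (intro mult_left_le_one_le) auto
  hence "\<alpha>\<^sup>2 * (1 + t * \<sigma>) \<le> \<alpha>\<^sup>2 * (1 + \<sigma>)" by (intro mult_left_mono) auto
  also have "\<dots> = 1 - \<sigma>\<^sup>2" by (simp add: \<sigma>_def power2_eq_square algebra_simps)
  also have "\<dots> \<le> 1" by simp
  finally have "\<alpha>\<^sup>2 \<le> 1 / (1 + t * \<sigma>)" using g by (simp add: field_simps)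
  hence "(t * \<alpha>\<^sup>2 * v\<^sup>2) * \<alpha>\<^sup>2 \<le> (t * \<alpha>\<^sup>2 * v\<^sup>2) * (1 / (1 + t * \<sigma>))"
    using t by (intro mult_left_mono) auto
  hence "exp (- (t * \<alpha>\<^sup>2 * v\<^sup>2) / (1 + t * \<sigma>)) \<le> exp (- (\<alpha> ^ 4 * t) * v\<^sup>2)"
    by (simp add: power4_eq_xxxx power2_eq_square mult_ac)
  moreover have "exp (- (t * \<alpha>\<^sup>2 * v\<^sup>2) / (1 + t * \<sigma>)) / (1 + t * \<sigma>)
      \<le> exp (- (t * \<alpha>\<^sup>2 * v\<^sup>2) / (1 + t * \<sigma>)) / 1"
    using g by (intro divide_left_mono) auto
  ultimately show ?thesis
    unfolding gain_transition_laplace[OF \<alpha> t(1)] \<sigma>_def[symmetric]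
    by (intro ennreal_leI) linarith
qed

subsection \<open>Iteration along the Markov chain\<close>

text \<open>The terminal function \<open>h\<close> makes induction on the path length possible:
  integrating out the last coordinate only changes \<open>h\<close>. For \<open>N = 0\<close> the
  endpoint is the starting point.\<close>

definition path_integral ::
  "(real \<Rightarrow> real \<Rightarrow> ennreal) \<Rightarrow> real \<Rightarrow> nat \<Rightarrow> (real \<Rightarrow> ennreal) \<Rightarrow> ennreal" where
  "path_integral W u0 N h =
    (\<integral>\<^sup>+u. (\<Prod>i\<in>{1..N}. W (if i = 1 then u0 else u (i - 1)) (u i)) * h (if N = 0 then u0 else u N)
      \<partial>(\<Pi>\<^sub>M i\<in>{1..N}. lborel))"

lemma path_integral_0: "path_integral W u0 0 h = h u0"
proof -
  interpret product_sigma_finite "\<lambda>_::nat. lborel :: real measure" by standard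
  show ?thesis by (simp add: path_integral_def nn_integral_empty space_PiM_empty emeasure_PiM_empty)
qed

text \<open>By Tonelli the coordinate \<open>Suc N\<close> can be integrated first; it occurs only
  in the last kernel and in \<open>h\<close>.\<close>

lemma path_integral_Suc:
  assumes [measurable]: "case_prod W \<in> borel_measurable (borel \<Otimes>\<^sub>M borel)" "h \<in> borel_measurable borel"
  shows "path_integral W u0 (Suc N) h = path_integral W u0 N (\<lambda>v. \<integral>\<^sup>+y. W v y * h y \<partial>lborel)"
proof -
  interpret product_sigma_finite "\<lambda>_::nat. lborel :: real measure" by standard
  define g where "g u = (\<Prod>i\<in>{1..N}. W (if i = 1 then u0 else u (i - 1)) (u i))" for u
  define v where "v u = (if N = 0 then u0 else u N)" for u
  have ins: "{1..Suc N} = insert (Suc N) {1..N}" by auto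
  \<comment> \<open>The conditional depends on the index alone, so for each \<open>i\<close> this is
    either a constant or a coordinate map.\<close>
  have prev: "(\<lambda>u. if i = 1 then u0 else u (i - 1)) \<in> borel_measurable (\<Pi>\<^sub>M i\<in>I. lborel)"
    if "1 \<le> i" "{1..<i} \<subseteq> I" for i :: nat and I
  proof (cases "i = 1")
    case False
    hence "i - 1 \<in> I" using that by auto
    thus ?thesis
      using False measurable_component_singleton[of "i - 1" I "\<lambda>_. lborel :: real measure"] by simp
  qed simp
  have fac: "(\<lambda>u. W (if i = 1 then u0 else u (i - 1)) (u i)) \<in> borel_measurable (\<Pi>\<^sub>M i\<in>{1..n}. lborel)"
    if "i \<in> {1..n}" for i n :: nat
  proof -
    have [measurable]: "(\<lambda>u. if i = 1 then u0 else u (i - 1)) \<in> borel_measurable (\<Pi>\<^sub>M i\<in>{1..n}. lborel)"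
      by (rule prev) (use that in auto)
    have [measurable]: "(\<lambda>u. u i) \<in> borel_measurable (\<Pi>\<^sub>M i\<in>{1..n}. (lborel :: real measure))"
      using measurable_component_singleton[OF that, of "\<lambda>_. lborel :: real measure"] by simp
    show ?thesis by measurable
  qed
  have [measurable]: "v \<in> borel_measurable (\<Pi>\<^sub>M i\<in>{1..N}. lborel)"
    using prev[of "Suc N" "{1..N}"] by (simp add: v_def [abs_def] atLeastLessThanSuc_atLeastAtMost cong: if_cong)
  have [measurable]: "g \<in> borel_measurable (\<Pi>\<^sub>M i\<in>{1..N}. lborel)"
    unfolding g_def [abs_def] using fac by (intro borel_measurable_prod_ennreal)
  have last: "(\<lambda>u. u (Suc N)) \<in> borel_measurable (\<Pi>\<^sub>M i\<in>{1..Suc N}. (lborel :: real measure))"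
    using measurable_component_singleton[of "Suc N" "{1..Suc N}" "\<lambda>_. lborel :: real measure"] by simp
  have "path_integral W u0 (Suc N) h =
      (\<integral>\<^sup>+u. \<integral>\<^sup>+y. g u * (W (v u) y * h y) \<partial>lborel \<partial>(\<Pi>\<^sub>M i\<in>{1..N}. lborel))"
    unfolding path_integral_def
  proof (subst ins, subst product_nn_integral_insert)
    show "(\<lambda>u. (\<Prod>i\<in>{1..Suc N}. W (if i = 1 then u0 else u (i - 1)) (u i)) *
        h (if Suc N = 0 then u0 else u (Suc N)))
        \<in> borel_measurable (Pi\<^sub>M (insert (Suc N) {1..N}) (\<lambda>i. lborel))"
      unfolding ins[symmetric]
      by (intro borel_measurable_times_ennreal borel_measurable_prod_ennreal fac)
        (use measurable_compose[OF last] in auto)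
    show "(\<integral>\<^sup>+x. \<integral>\<^sup>+y. (\<Prod>i\<in>{1..Suc N}. W (if i = 1 then u0 else (x(Suc N := y)) (i - 1))
            ((x(Suc N := y)) i)) *
          h (if Suc N = 0 then u0 else (x(Suc N := y)) (Suc N)) \<partial>lborel \<partial>(\<Pi>\<^sub>M i\<in>{1..N}. lborel)) =
        (\<integral>\<^sup>+u. \<integral>\<^sup>+y. g u * (W (v u) y * h y) \<partial>lborel \<partial>(\<Pi>\<^sub>M i\<in>{1..N}. lborel))"
    proof (intro nn_integral_cong)
      fix x :: "nat \<Rightarrow> real" and y
      have "(\<Prod>i\<in>{1..N}. W (if i = 1 then u0 else (x(Suc N := y)) (i - 1)) ((x(Suc N := y)) i)) = g x"
        unfolding g_def by (intro prod.cong) auto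
      thus "(\<Prod>i\<in>{1..Suc N}. W (if i = 1 then u0 else (x(Suc N := y)) (i - 1)) ((x(Suc N := y)) i)) *
          h (if Suc N = 0 then u0 else (x(Suc N := y)) (Suc N)) = g x * (W (v x) y * h y)"
        unfolding ins by (subst prod.insert) (auto simp: v_def mult_ac)
    qed
  qed auto
  also have "\<dots> = path_integral W u0 N (\<lambda>v. \<integral>\<^sup>+y. W v y * h y \<partial>lborel)"
    unfolding path_integral_def g_def[symmetric] v_def[symmetric]
    by (intro nn_integral_cong nn_integral_cmult) measurable
  finally show ?thesis .
qed

lemma path_integral_mono:
  assumes "\<And>v. h v \<le> h' v"
  shows "path_integral W u0 N h \<le> path_integral W u0 N h'"
  unfolding path_integral_def using assms by (intro nn_integral_mono mult_left_mono) auto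

text \<open>The path is integrated from its end backwards, and \<open>n\<close> counts the steps
  already integrated out. Each step raises the index of \<open>H\<close> by one, hence the induction
  on \<open>N\<close> with arbitrary \<open>n\<close>.\<close>

lemma path_integral_supersolution:
  assumes W: "case_prod W \<in> borel_measurable (borel \<Otimes>\<^sub>M borel)"
    and H: "\<And>n. H n \<in> borel_measurable borel"
    and step: "\<And>n v. (\<integral>\<^sup>+y. W v y * H n y \<partial>lborel) \<le> H (Suc n) v"
  shows "path_integral W u0 N (H n) \<le> H (N + n) u0"
proof (induction N arbitrary: n)
  case 0
  show ?case by (simp add: path_integral_0)
next
  case (Suc N)
  have "path_integral W u0 (Suc N) (H n) \<le> path_integral W u0 N (H (Suc n))"
    unfolding path_integral_Suc[OF W H] by (intro path_integral_mono step)
  also have "\<dots> \<le> H (Suc N + n) u0" using Suc.IH[of "Suc n"] by simp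
  finally show ?case .
qed

lemma path_integral_markov:
  assumes W: "case_prod W \<in> borel_measurable (borel \<Otimes>\<^sub>M borel)"
    and "\<And>v. (\<integral>\<^sup>+y. W v y \<partial>lborel) = 1"
  shows "path_integral W u0 N (\<lambda>_. 1) = 1"
  using assms(2) by (induction N) (simp_all add: path_integral_0 path_integral_Suc[OF W])

section \<open>Expectations of products under the law of the gains\<close>

lemma measurable_gain_path [measurable]:
  fixes N :: nat
  shows
  "(\<lambda>u. ennreal (\<Prod>i\<in>{1..N}. gain_transition \<alpha> (if i = 1 then u0 else u (i - 1)) (u i)))
    \<in> borel_measurable (\<Pi>\<^sub>M i\<in>{1..N}. lborel)"
proof (intro measurable_compose[OF _ measurable_ennreal] borel_measurable_prod measurable_gain_transition)
  fix i assume i: "i \<in> {1..N}"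
  show "(\<lambda>u. u i) \<in> borel_measurable (\<Pi>\<^sub>M i\<in>{1..N}. (lborel :: real measure))"
    using measurable_component_singleton[OF i, of "\<lambda>_. lborel :: real measure"] by simp
  show "(\<lambda>u. if i = 1 then u0 else u (i - 1)) \<in> borel_measurable (\<Pi>\<^sub>M i\<in>{1..N}. (lborel :: real measure))"
  proof (cases "i = 1")
    case False
    hence "i - 1 \<in> {1..N}" using i by auto
    thus ?thesis
      using False measurable_component_singleton[of "i - 1" "{1..N}" "\<lambda>_. lborel :: real measure"] by simp
  qed simp
qed

lemma measurable_gain_product:
  fixes N :: nat
  assumes [measurable]: "f \<in> borel_measurable borel"
  shows "(\<lambda>u. \<Prod>i\<in>{1..N}. f (u i) :: real) \<in> borel_measurable (\<Pi>\<^sub>M i\<in>{1..N}. (lborel :: real measure))"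
proof (intro borel_measurable_prod)
  fix i assume i: "i \<in> {1..N}"
  show "(\<lambda>u. f (u i)) \<in> borel_measurable (\<Pi>\<^sub>M i\<in>{1..N}. (lborel :: real measure))"
    using measurable_component_singleton[OF i, of "\<lambda>_. lborel :: real measure"] by simp
qed

text \<open>Each factor \<open>f (u i)\<close> is absorbed into the kernel of its own step, so a
  product along the path becomes a path integral with terminal function 1.\<close>

lemma nn_integral_gain_law:
  assumes \<alpha>: "\<alpha>\<^sup>2 < 1" and [measurable]: "f \<in> borel_measurable borel" and f: "\<And>u. 0 \<le> f u"
  shows "(\<integral>\<^sup>+u. ennreal (\<Prod>i\<in>{1..N}. f (u i)) \<partial>gain_law u0 \<alpha> N) =
    path_integral (\<lambda>v u. ennreal (gain_transition \<alpha> v u * f u)) u0 N (\<lambda>_. 1)"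
proof -
  note [measurable] = measurable_gain_product[of f N]
  show ?thesis
    unfolding gain_law_def path_integral_def
    using measurable_gain_path[of \<alpha> u0 N]
    by (subst nn_integral_density)
      (auto intro!: nn_integral_cong simp: prod.distrib prod_nonneg prod_ennreal f
        gain_transition_nonneg[OF \<alpha>] ennreal_mult'[symmetric])
qed

lemma prob_space_gain_law:
  assumes \<alpha>: "\<alpha>\<^sup>2 < 1"
  shows "prob_space (gain_law u0 \<alpha> N)"
proof
  have "emeasure (gain_law u0 \<alpha> N) (space (gain_law u0 \<alpha> N)) =
      (\<integral>\<^sup>+u. ennreal (\<Prod>i\<in>{1..N}. 1) \<partial>gain_law u0 \<alpha> N)"
    by simp
  also have "\<dots> = 1"
    by (subst nn_integral_gain_law[OF \<alpha>])
      (auto intro!: path_integral_markov simp: nn_integral_gain_transition[OF \<alpha>])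
  finally show "emeasure (gain_law u0 \<alpha> N) (space (gain_law u0 \<alpha> N)) = 1" .
qed

text \<open>An inductive form of the estimate that separates the paths staying above \<open>b\<close>, which
  contribute \<open>B\<close> per step, from those falling below it, which are controlled by the Chernoff bound
  \<open>exp (b - u\<^sup>2)\<close>.\<close>

lemma nn_integral_gain_law_le:
  assumes \<alpha>: "\<alpha>\<^sup>2 < 1" and fm [measurable]: "f \<in> borel_measurable borel"
    and f: "\<And>u. 0 \<le> f u" "\<And>u. f u \<le> 1" and fb: "\<And>u. b \<le> u\<^sup>2 \<Longrightarrow> f u \<le> B" and B: "0 \<le> B"
  shows "(\<integral>\<^sup>+u. ennreal (\<Prod>i\<in>{1..N}. f (u i)) \<partial>gain_law u0 \<alpha> N) \<le>
    ennreal (B ^ N + real N * exp (b - (\<alpha> ^ 4) ^ N * u0\<^sup>2))"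
proof -
  \<comment> \<open>\<open>e n v\<close> is the Chernoff bound for being below \<open>b\<close>
    after \<open>n\<close> steps from \<open>v\<close>. \<open>H n v\<close> adds up
    \<open>n\<close> such bounds, each with the weakest exponent, and serves as the
    supersolution.\<close>
  define e where "e n v = exp (b - (\<alpha> ^ 4) ^ n * v\<^sup>2)" for n v
  define H where "H n v = ennreal (B ^ n + real n * e n v)" for n v
  have \<alpha>4: "0 \<le> \<alpha> ^ 4" "\<alpha> ^ 4 \<le> 1"
    using \<alpha> power_le_one[of "\<alpha>\<^sup>2" 2] by (auto simp flip: power_mult)
  have [measurable]: "e n \<in> borel_measurable borel" for n
    unfolding e_def [abs_def] by measurable
  have "path_integral (\<lambda>v u. ennreal (gain_transition \<alpha> v u * f u)) u0 N (H 0) \<le> H (N + 0) u0"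
  proof (rule path_integral_supersolution)
    fix n v
    \<comment> \<open>One more factor \<open>f u\<close> costs either a factor \<open>B\<close> or
      one more copy of \<open>e n u\<close>. The bound is kept in terms of \<open>e n u\<close>,
      since the Laplace estimate turns it into \<open>e (Suc n) v\<close> afterwards. If
      \<open>B > 1\<close>, then \<open>f u \<le> 1\<close> already suffices.\<close>
    have pw: "f u * (B ^ n + real n * e n u) \<le> B ^ Suc n + real (Suc n) * e n u" for u
    proof -
      have "f u \<le> B + e n u"
      proof (cases "b \<le> u\<^sup>2")
        case True
        thus ?thesis using fb[OF True] by (simp add: e_def add_increasing2)
      next
        case False
        have "(\<alpha> ^ 4) ^ n * u\<^sup>2 \<le> 1 * u\<^sup>2"
          by (intro mult_right_mono power_le_one[OF \<alpha>4] zero_le_power2)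
        hence "1 \<le> e n u" using False by (simp add: e_def)
        thus ?thesis using f(2)[of u] B by linarith
      qed
      show ?thesis
      proof (cases "B \<le> 1")
        case True
        have "f u * B ^ n \<le> (B + e n u) * B ^ n"
          using B \<open>f u \<le> B + e n u\<close> by (intro mult_right_mono) auto
        moreover have "e n u * B ^ n \<le> e n u"
          using B True by (intro mult_left_le) (auto simp: e_def power_le_one)
        moreover have "f u * (real n * e n u) \<le> real n * e n u"
          using f by (intro mult_left_le_one_le) (auto simp: e_def)
        ultimately show ?thesis by (simp add: algebra_simps)
      next
        case False
        have "f u * (B ^ n + real n * e n u) \<le> B ^ n + real n * e n u"
          using f B by (intro mult_left_le_one_le) (auto simp: e_def)
        moreover have "B ^ n \<le> B ^ Suc n" using False by (intro power_increasing) auto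
        moreover have "0 \<le> e n u" by (simp add: e_def)
        ultimately show ?thesis by (simp add: algebra_simps)
      qed
    qed
    have "(\<integral>\<^sup>+u. ennreal (gain_transition \<alpha> v u * f u) * H n u \<partial>lborel) \<le>
        (\<integral>\<^sup>+u. ennreal (B ^ Suc n) * ennreal (gain_transition \<alpha> v u) +
           ennreal (real (Suc n) * exp b) *
           (ennreal (gain_transition \<alpha> v u) * ennreal (exp (- ((\<alpha> ^ 4) ^ n) * u\<^sup>2))) \<partial>lborel)"
    proof (intro nn_integral_mono)
      fix u
      have e: "e n u = exp b * exp (- ((\<alpha> ^ 4) ^ n) * u\<^sup>2)"
        by (simp add: e_def exp_add[symmetric])
      have q: "0 \<le> gain_transition \<alpha> v u" by (rule gain_transition_nonneg[OF \<alpha>])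
      have "ennreal (gain_transition \<alpha> v u * f u) * H n u =
          ennreal (gain_transition \<alpha> v u * (f u * (B ^ n + real n * e n u)))"
        unfolding H_def using q f B
        by (subst ennreal_mult'[symmetric]) (auto simp: mult.assoc)
      also have "\<dots> \<le> ennreal (gain_transition \<alpha> v u * (B ^ Suc n + real (Suc n) * e n u))"
        by (intro ennreal_leI mult_left_mono pw q)
      also have "gain_transition \<alpha> v u * (B ^ Suc n + real (Suc n) * e n u) =
          B ^ Suc n * gain_transition \<alpha> v u +
           real (Suc n) * exp b * (gain_transition \<alpha> v u * exp (- ((\<alpha> ^ 4) ^ n) * u\<^sup>2))"
        unfolding e by (simp only: distrib_left mult_ac)
      also have "ennreal \<dots> = ennreal (B ^ Suc n) * ennreal (gain_transition \<alpha> v u) +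
           ennreal (real (Suc n) * exp b) *
           (ennreal (gain_transition \<alpha> v u) * ennreal (exp (- ((\<alpha> ^ 4) ^ n) * u\<^sup>2)))"
        using q B by (simp only: ennreal_mult' ennreal_plus mult_nonneg_nonneg zero_le_power
          exp_ge_zero of_nat_0_le_iff)
      finally show "ennreal (gain_transition \<alpha> v u * f u) * H n u \<le> \<dots>" .
    qed
    also have "\<dots> = ennreal (B ^ Suc n) * (\<integral>\<^sup>+u. ennreal (gain_transition \<alpha> v u) \<partial>lborel) +
        ennreal (real (Suc n) * exp b) *
          (\<integral>\<^sup>+u. ennreal (gain_transition \<alpha> v u) * ennreal (exp (- ((\<alpha> ^ 4) ^ n) * u\<^sup>2)) \<partial>lborel)"
      by (subst nn_integral_add, measurable, subst nn_integral_cmult, measurable,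
        subst nn_integral_cmult, measurable)
    \<comment> \<open>The Laplace bound is applied at \<open>t = (\<alpha> ^ 4) ^ n\<close>, which
      lies in the unit interval.\<close>
    also have "\<dots> \<le> ennreal (B ^ Suc n) * 1 + ennreal (real (Suc n) * exp b) *
        ennreal (exp (- (\<alpha> ^ 4 * (\<alpha> ^ 4) ^ n) * v\<^sup>2))"
      unfolding nn_integral_gain_transition[OF \<alpha>] using \<alpha>4
      by (intro add_left_mono mult_left_mono gain_transition_laplace_le[OF \<alpha>]
        power_le_one[OF \<alpha>4] zero_le_power[OF \<alpha>4(1)]) auto
    also have "\<dots> = ennreal (B ^ Suc n + real (Suc n) * (exp b * exp (- (\<alpha> ^ 4 * (\<alpha> ^ 4) ^ n) * v\<^sup>2)))"
      using B by (simp only: ennreal_mult' ennreal_plus mult_nonneg_nonneg zero_le_power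
          exp_ge_zero of_nat_0_le_iff mult_1_right mult.assoc)
    also have "\<dots> = H (Suc n) v"
      by (simp only: H_def e_def exp_add[symmetric] power_Suc) simp
    finally show "(\<integral>\<^sup>+u. ennreal (gain_transition \<alpha> v u * f u) * H n u \<partial>lborel) \<le> H (Suc n) v" .
  qed (auto simp: H_def [abs_def])
  also have "H 0 = (\<lambda>_. 1)" by (simp add: H_def fun_eq_iff)
  finally show ?thesis
    unfolding nn_integral_gain_law[OF \<alpha> fm f(1)] by (simp add: H_def e_def)
qed

text \<open>Transfer to the Bochner integral in which the error exponent is stated; the product lies
  between 0 and 1 and is thus integrable. Strict positivity makes the logarithm of the integral
  meaningful.\<close>

lemma integral_gain_law_bounds:
  assumes \<alpha>: "\<alpha>\<^sup>2 < 1" and fm [measurable]: "f \<in> borel_measurable borel"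
    and f: "\<And>u. 0 < f u" "\<And>u. f u \<le> 1" and fb: "\<And>u. b \<le> u\<^sup>2 \<Longrightarrow> f u \<le> B" and B: "0 \<le> B"
  shows "0 < (\<integral>u. (\<Prod>i\<in>{1..N}. f (u i)) \<partial>gain_law u0 \<alpha> N)"
    and "(\<integral>u. (\<Prod>i\<in>{1..N}. f (u i)) \<partial>gain_law u0 \<alpha> N) \<le>
      B ^ N + real N * exp (b - (\<alpha> ^ 4) ^ N * u0\<^sup>2)"
proof -
  interpret prob_space "gain_law u0 \<alpha> N" by (rule prob_space_gain_law[OF \<alpha>])
  define F where "F u = (\<Prod>i\<in>{1..N}. f (u i))" for u
  have F: "0 < F u" "F u \<le> 1" for u
    using f unfolding F_def by (blast intro: prod_pos prod_le_1 less_imp_le)+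
  have [measurable]: "F \<in> borel_measurable (gain_law u0 \<alpha> N)"
    using measurable_gain_product[OF fm, of N] unfolding F_def [abs_def] gain_law_def by simp
  have int: "integrable (gain_law u0 \<alpha> N) F"
    by (rule integrable_const_bound[of _ 1]) (use F in \<open>auto simp: less_imp_le\<close>)
  have "0 < (\<integral>u. F u \<partial>gain_law u0 \<alpha> N)"
    using F int not_empty emeasure_space_1
    using integral_less_AE_space[of "\<lambda>_. 0" F] by simp
  thus "0 < (\<integral>u. (\<Prod>i\<in>{1..N}. f (u i)) \<partial>gain_law u0 \<alpha> N)"
    by (simp add: F_def)
  have "ennreal (\<integral>u. F u \<partial>gain_law u0 \<alpha> N) = (\<integral>\<^sup>+u. ennreal (F u) \<partial>gain_law u0 \<alpha> N)"
    using int F by (subst nn_integral_eq_integral) (auto simp: less_imp_le)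
  also have "\<dots> \<le> ennreal (B ^ N + real N * exp (b - (\<alpha> ^ 4) ^ N * u0\<^sup>2))"
    unfolding F_def by (rule nn_integral_gain_law_le[OF \<alpha> fm _ _ fb B]) (use f in \<open>auto simp: less_imp_le\<close>)
  finally show "(\<integral>u. (\<Prod>i\<in>{1..N}. f (u i)) \<partial>gain_law u0 \<alpha> N) \<le>
      B ^ N + real N * exp (b - (\<alpha> ^ 4) ^ N * u0\<^sup>2)"
    unfolding F_def using B by (subst (asm) ennreal_le_iff) (auto intro!: add_nonneg_nonneg)
qed

subsection \<open>Throughput of a single user\<close>

text \<open>The infimum is at most its value at the given \<open>\<rho>\<close>. There the factor
  \<open>N\<close> and the logarithm cancel, which leaves \<open>exp (N * \<rho> * R)\<close> times
  the expected product, and that is split at the power level \<open>b\<close>.\<close>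

lemma user_throughput_ge:
  assumes \<alpha>: "\<alpha>\<^sup>2 < 1" and P: "0 < P" and \<rho>: "0 \<le> \<rho>" "\<rho> \<le> 1" and N: "1 \<le> N" and R: "0 \<le> R"
    and b: "0 \<le> b"
  shows "R * (1 - exp (real N * \<rho> * R) *
      (((1 / (1 + P / (1 + \<rho>) * b)) powr \<rho>) ^ N + real N * exp (b - (\<alpha> ^ 4) ^ N * u0\<^sup>2)))
    \<le> user_throughput P u0 \<alpha> N R"
proof -
  define f where "f u = (1 / (1 + P / (1 + \<rho>) * u\<^sup>2)) powr \<rho>" for u
  define I where "I = (\<integral>u. (\<Prod>i\<in>{1..N}. f (u i)) \<partial>gain_law u0 \<alpha> N)"
  define C where "C = ((1 / (1 + P / (1 + \<rho>) * b)) powr \<rho>) ^ N + real N * exp (b - (\<alpha> ^ 4) ^ N * u0\<^sup>2)"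
  have pos: "0 < 1 + P / (1 + \<rho>) * y" if "0 \<le> y" for y
    using P \<rho> that by (intro add_pos_nonneg) auto
  have fm: "f \<in> borel_measurable borel" unfolding f_def [abs_def] by measurable
  have f0: "0 < f u" for u using pos[of "u\<^sup>2"] by (simp add: f_def)
  have f1: "f u \<le> 1" for u
    using P \<rho> pos[of "u\<^sup>2"] unfolding f_def by (intro powr_le1) (auto simp: divide_simps)
  have fb: "f u \<le> (1 / (1 + P / (1 + \<rho>) * b)) powr \<rho>" if "b \<le> u\<^sup>2" for u
    unfolding f_def using P \<rho> pos[of "u\<^sup>2"] pos[OF b] that
    by (intro powr_mono2 divide_left_mono add_left_mono mult_left_mono) auto
  have I: "0 < I" "I \<le> C"
    unfolding I_def C_def by (rule integral_gain_law_bounds[OF \<alpha> fm f0 f1 fb]; simp)+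
  have "(INF r\<in>{0..1}. exp (- real N * (error_exponent P N r u0 \<alpha> - r * R)))
      \<le> exp (- real N * (error_exponent P N \<rho> u0 \<alpha> - \<rho> * R))"
    using \<rho> by (intro cINF_lower bdd_belowI[of _ 0]) auto
  also have "error_exponent P N \<rho> u0 \<alpha> = - (1 / real N) * ln I"
    by (simp add: error_exponent_def I_def f_def)
  also have "- real N * (- (1 / real N) * ln I - \<rho> * R) = real N * \<rho> * R + ln I"
    using N by (simp add: algebra_simps)
  also have "exp \<dots> = exp (real N * \<rho> * R) * I"
    using I by (simp add: exp_add)
  also have "\<dots> \<le> exp (real N * \<rho> * R) * C"
    using I by simp
  finally show ?thesis
    unfolding user_throughput_def C_def[symmetric] using R by (intro mult_left_mono) auto
qed

text \<open>With \<open>R = ln (P L) - c / 2\<close>, a small constant \<open>\<rho>\<close> and \<open>N\<close> about \<open>ln L\<close>, the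
  gain stays above \<open>exp (- c / 8) * L\<close> during the whole codeword, up to a probability that is
  exponentially small in \<open>L\<close>.\<close>

lemma eventually_user_throughput_ge:
  fixes P c :: real
  assumes P: "0 < P" and c: "0 < c"
  obtains \<eta> where "0 < \<eta>" "\<eta> < 1"
    "\<forall>\<^sub>F L in at_top. \<forall>u0 \<alpha>. (1 - \<eta>) * L \<le> u0\<^sup>2 \<longrightarrow> 1 - 1 / sqrt L \<le> \<alpha> \<longrightarrow> 0 < \<alpha> \<longrightarrow> \<alpha> < 1 \<longrightarrow>
       (\<exists>N\<ge>1. \<exists>R\<ge>0. ln (P * L) - c \<le> user_throughput P u0 \<alpha> N R)"
proof -
  \<comment> \<open>Penalties of at most \<open>c / 8\<close> from \<open>ln (1 + \<rho>)\<close>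
    and of \<open>c / 8\<close> from the level \<open>exp (- c / 8) * L\<close> together use half of
    the margin \<open>c / 2\<close> in the rate. The choice of \<open>\<eta>\<close> makes
    \<open>1 - \<eta> = exp (- c / 8) + \<eta>\<close>, so the initial power exceeds that level by
    at least \<open>\<eta> * L\<close>.\<close>
  define \<rho> where "\<rho> = min 1 (c / 8)"
  define \<eta> where "\<eta> = (1 - exp (- c / 8)) / 2"
  have \<rho>: "0 < \<rho>" "\<rho> \<le> 1" "\<rho> \<le> c / 8" using c by (auto simp: \<rho>_def)
  have \<eta>: "0 < \<eta>" "\<eta> < 1" using c by (auto simp: \<eta>_def add_pos_pos intro: less_trans[of _ 0])
  \<comment> \<open>The first term comes from paths that stay above the level, the second from those
    that fall below it. In the second, \<open>- \<eta> * L\<close> dominates every other part of the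
    exponent.\<close>
  define err where "err L = exp (- (\<rho> * c / 4) * ln L) +
    (ln L + 1) * exp ((ln L + 1) * \<rho> * ln (P * L) - \<eta> * L + 4 * (ln L + 1) * sqrt L)" for L
  have "((\<lambda>L. ln (P * L) * err L) \<longlongrightarrow> 0) at_top"
    unfolding err_def using P \<rho>(1) \<eta>(1) c by real_asymp
  hence ev1: "\<forall>\<^sub>F L in at_top. ln (P * L) * err L < c / 2"
    using c by (intro order_tendstoD) auto
  have ev2: "\<forall>\<^sub>F L in at_top. c / 2 \<le> ln (P * L)"
    using P by real_asymp
  have ev3: "\<forall>\<^sub>F L in at_top. (1::real) < L" by real_asymp
  have "\<forall>\<^sub>F L in at_top. \<forall>u0 \<alpha>. (1 - \<eta>) * L \<le> u0\<^sup>2 \<longrightarrow> 1 - 1 / sqrt L \<le> \<alpha> \<longrightarrow> 0 < \<alpha> \<longrightarrow> \<alpha> < 1 \<longrightarrow>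
       (\<exists>N\<ge>1. \<exists>R\<ge>0. ln (P * L) - c \<le> user_throughput P u0 \<alpha> N R)"
    using ev1 ev2 ev3
  proof eventually_elim
    case (elim L)
    show ?case
    proof (intro allI impI)
      fix u0 \<alpha> :: real
      assume u0: "(1 - \<eta>) * L \<le> u0\<^sup>2" and \<alpha>: "1 - 1 / sqrt L \<le> \<alpha>" "0 < \<alpha>" "\<alpha> < 1"
      define R where "R = ln (P * L) - c / 2"
      \<comment> \<open>This length makes \<open>exp (- (\<rho> * c / 4) * N)\<close> a negative
        power of \<open>L\<close>, which beats the logarithmic rate, while the total fading loss
        \<open>4 * N * sqrt L\<close> remains \<open>o(L)\<close>.\<close>
      define N where "N = nat \<lceil>ln L\<rceil>"
      define b where "b = exp (- c / 8) * L"
      have L: "0 < L" "0 < ln L" using elim by auto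
      have N: "1 \<le> N" "ln L \<le> real N" "real N \<le> ln L + 1"
        using L unfolding N_def by linarith+
      have R: "0 \<le> R" using elim by (simp add: R_def)
      have b: "0 < b" using L by (simp add: b_def)
      have \<alpha>2: "\<alpha>\<^sup>2 < 1" using \<alpha> by (simp add: power_less_one_iff)
      define B where "B = (1 / (1 + P / (1 + \<rho>) * b)) powr \<rho>"
      have "B \<le> (1 / (P / (1 + \<rho>) * b)) powr \<rho>"
        unfolding B_def using P \<rho> b
        by (intro powr_mono2 divide_left_mono) (auto intro!: mult_pos_pos divide_pos_pos add_pos_pos)
      also have "\<dots> = exp (\<rho> * (ln (1 + \<rho>) - ln (P * L) + c / 8))"
        using P \<rho> L by (simp add: powr_def b_def ln_mult ln_div algebra_simps)
      also have "\<dots> \<le> exp (\<rho> * (c / 4 - ln (P * L)))"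
        using \<rho> ln_add_one_self_le_self[of \<rho>] by (simp add: mult_left_mono)
      finally have "B ^ N \<le> exp (\<rho> * (c / 4 - ln (P * L))) ^ N"
        by (intro power_mono) (simp_all add: B_def)
      hence "exp (real N * \<rho> * R) * B ^ N \<le> exp (real N * \<rho> * R) * exp (\<rho> * (c / 4 - ln (P * L))) ^ N"
        by simp
      \<comment> \<open>Per symbol the exponent is \<open>\<rho> * (R + c / 4 - ln (P * L))\<close>,
        and \<open>R = ln (P * L) - c / 2\<close>.\<close>
      also have "\<dots> = exp (- (\<rho> * c / 4) * real N)"
        unfolding exp_of_nat_mult[symmetric] exp_add[symmetric] R_def by (simp add: algebra_simps)
      also have "\<dots> \<le> exp (- (\<rho> * c / 4) * ln L)"
        using \<rho> c N by (simp add: mult_left_mono)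
      finally have e1: "exp (real N * \<rho> * R) * B ^ N \<le> exp (- (\<rho> * c / 4) * ln L)" .

      \<comment> \<open>Bernoulli's inequality bounds the shrinkage of the Laplace parameter over
        the whole codeword by \<open>4 * N / sqrt L\<close>.\<close>
      have "1 - 4 * real N * (1 - \<alpha>) = 1 + real (4 * N) * (\<alpha> - 1)" by (simp add: algebra_simps)
      also have "\<dots> \<le> (1 + (\<alpha> - 1)) ^ (4 * N)" using \<alpha> by (intro Bernoulli_inequality) auto
      finally have "1 - 4 * real N * (1 - \<alpha>) \<le> (\<alpha> ^ 4) ^ N" by (simp add: power_mult)
      moreover have "4 * real N * (1 - \<alpha>) \<le> 4 * real N * (1 / sqrt L)"
        using \<alpha> by (intro mult_left_mono) auto
      ultimately have "1 - 4 * real N / sqrt L \<le> (\<alpha> ^ 4) ^ N" by simp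
      hence "(1 - 4 * real N / sqrt L) * ((1 - \<eta>) * L) \<le> (\<alpha> ^ 4) ^ N * ((1 - \<eta>) * L)"
        using L \<eta> by (intro mult_right_mono) auto
      also have "\<dots> \<le> (\<alpha> ^ 4) ^ N * u0\<^sup>2" using u0 by (intro mult_left_mono) auto
      also have "(1 - 4 * real N / sqrt L) * ((1 - \<eta>) * L) = (1 - \<eta>) * L - (1 - \<eta>) * (4 * real N * sqrt L)"
      proof -
        have "L / sqrt L = sqrt L" using L by (simp add: real_div_sqrt)
        hence "4 * real N / sqrt L * L = 4 * real N * sqrt L" by (metis times_divide_eq_left times_divide_eq_right)
        moreover have "(1 - y) * (w * L) = w * L - w * (y * L)" for y w by (simp add: algebra_simps)
        ultimately show ?thesis by metis
      qed
      finally have "(1 - \<eta>) * L - (1 - \<eta>) * (4 * real N * sqrt L) \<le> (\<alpha> ^ 4) ^ N * u0\<^sup>2" .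
      moreover have "(1 - \<eta>) * (4 * real N * sqrt L) \<le> 4 * (ln L + 1) * sqrt L"
      proof -
        have "(1 - \<eta>) * (4 * real N * sqrt L) \<le> 4 * real N * sqrt L"
          using L \<eta> by (intro mult_left_le_one_le) auto
        also have "\<dots> \<le> 4 * (ln L + 1) * sqrt L" using N L by (intro mult_right_mono) auto
        finally show ?thesis .
      qed
      moreover have "b = (1 - \<eta>) * L - \<eta> * L"
        by (simp add: b_def \<eta>_def algebra_simps flip: distrib_right)
      moreover have "real N * \<rho> * R \<le> (ln L + 1) * \<rho> * ln (P * L)"
        using N \<rho> R c L by (intro mult_mono) (auto simp: R_def)
      ultimately have "real N * \<rho> * R + (b - (\<alpha> ^ 4) ^ N * u0\<^sup>2) \<le>
          (ln L + 1) * \<rho> * ln (P * L) - \<eta> * L + 4 * (ln L + 1) * sqrt L"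
        by linarith
      hence "real N * exp (real N * \<rho> * R + (b - (\<alpha> ^ 4) ^ N * u0\<^sup>2)) \<le>
          (ln L + 1) * exp ((ln L + 1) * \<rho> * ln (P * L) - \<eta> * L + 4 * (ln L + 1) * sqrt L)"
        using N L by (intro mult_mono) auto
      hence "exp (real N * \<rho> * R) * (B ^ N + real N * exp (b - (\<alpha> ^ 4) ^ N * u0\<^sup>2)) \<le> err L"
        using e1 by (simp add: err_def exp_add distrib_left mult.left_commute)
      hence "R * (1 - err L) \<le> R * (1 - exp (real N * \<rho> * R) * (B ^ N + real N * exp (b - (\<alpha> ^ 4) ^ N * u0\<^sup>2)))"
        using R by (intro mult_left_mono) auto
      also have "\<dots> \<le> user_throughput P u0 \<alpha> N R"
        unfolding B_def using \<alpha>2 P \<rho> N R b by (intro user_throughput_ge) auto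
      finally have "R * (1 - err L) \<le> user_throughput P u0 \<alpha> N R" .
      moreover have "R * err L \<le> ln (P * L) * err L"
        using L c by (intro mult_right_mono) (auto simp: R_def err_def intro!: add_nonneg_nonneg)
      hence "ln (P * L) - c \<le> R * (1 - err L)"
        using elim(1) by (simp add: R_def right_diff_distrib)
      ultimately have "ln (P * L) - c \<le> user_throughput P u0 \<alpha> N R" by linarith
      thus "\<exists>N\<ge>1. \<exists>R\<ge>0. ln (P * L) - c \<le> user_throughput P u0 \<alpha> N R"
        using N(1) R by blast
    qed
  qed
  thus ?thesis using that \<eta> by blast
qed

subsection \<open>The selected user\<close>

text \<open>\<open>arg_max_on\<close> is a choice operator, so its properties follow once some
  maximizer is exhibited; a preimage of the maximum of the finite image is one.\<close>

lemma arg_max_on_finite: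
  fixes f :: "'b \<Rightarrow> 'c :: linorder"
  assumes "finite S" "S \<noteq> {}"
  shows "arg_max_on f S \<in> S" "\<And>x. x \<in> S \<Longrightarrow> f x \<le> f (arg_max_on f S)"
proof -
  have "Max (f ` S) \<in> f ` S" using assms by (intro Max_in) auto
  then obtain m where "m \<in> S" "f m = Max (f ` S)" by auto
  hence "is_arg_max f (\<lambda>x. x \<in> S) m"
    using assms by (simp add: is_arg_max_linorder)
  hence "is_arg_max f (\<lambda>x. x \<in> S) (arg_max_on f S)"
    unfolding arg_max_on_def arg_max_def by (rule someI)
  thus "arg_max_on f S \<in> S" "\<And>x. x \<in> S \<Longrightarrow> f x \<le> f (arg_max_on f S)"
    by (auto simp: is_arg_max_linorder)
qed

section \<open>Probability that a good user reports\<close>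

lemma nn_integral_rayleigh_tail:
  assumes "0 \<le> \<theta>"
  shows "(\<integral>\<^sup>+x. ennreal (rayleigh_density x) * indicator {sqrt \<theta>..} x \<partial>lborel) = ennreal (exp (- \<theta>))"
proof -
  have "(\<integral>\<^sup>+x. ennreal (rayleigh_density x) * indicator {sqrt \<theta>..} x \<partial>lborel) =
      (\<integral>\<^sup>+x. ennreal (2 * x * exp (- x\<^sup>2)) * indicator {sqrt \<theta>..} x \<partial>lborel)"
    using order_trans[OF real_sqrt_ge_zero[OF assms]]
    by (intro nn_integral_cong) (auto simp: rayleigh_density_def indicator_def)
  also have "\<dots> = ennreal (0 - (- exp (- (sqrt \<theta>)\<^sup>2)))"
  proof (rule nn_integral_FTC_atLeast)
    show "((\<lambda>x::real. - exp (- x\<^sup>2)) \<longlongrightarrow> 0) at_top" by real_asymp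
    show "((\<lambda>x. - exp (- x\<^sup>2)) has_real_derivative 2 * x * exp (- x\<^sup>2)) (at x)" for x :: real
      by (auto intro!: derivative_eq_intros)
    show "0 \<le> 2 * x * exp (- x\<^sup>2)" if "sqrt \<theta> \<le> x" for x
      using order_trans[OF real_sqrt_ge_zero[OF assms] that] by simp
  qed simp
  finally show ?thesis using assms by simp
qed

text \<open>The event \<open>sqrt \<theta> \<le> X\<close> has exactly this probability and is
  contained in \<open>\<theta> \<le> X\<^sup>2\<close>.\<close>

lemma (in prob_space) prob_rayleigh_ge:
  assumes X: "distributed M lborel X (\<lambda>x. ennreal (rayleigh_density x))" and "0 \<le> \<theta>"
  shows "exp (- \<theta>) \<le> prob (X -` {x. \<theta> \<le> x\<^sup>2} \<inter> space M)"
proof -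
  have [measurable]: "X \<in> borel_measurable M" using distributed_measurable[OF X] by simp
  have "ennreal (exp (- \<theta>)) = emeasure M (X -` {sqrt \<theta>..} \<inter> space M)"
    unfolding nn_integral_rayleigh_tail[OF assms(2), symmetric]
    by (rule distributed_emeasure[OF X, symmetric]) simp
  also have "\<dots> \<le> emeasure M (X -` {x. \<theta> \<le> x\<^sup>2} \<inter> space M)"
  proof (rule emeasure_mono)
    show "X -` {sqrt \<theta>..} \<inter> space M \<subseteq> X -` {x. \<theta> \<le> x\<^sup>2} \<inter> space M"
      using assms(2) sqrt_le_D by auto
    show "X -` {x. \<theta> \<le> x\<^sup>2} \<inter> space M \<in> events" by measurable
  qed
  finally show ?thesis by (simp add: emeasure_eq_measure)
qed

lemma (in prob_space) prob_uniform_gt: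
  assumes X: "distributed M lborel X (indicator {0<..<1::real})" and x: "0 \<le> x" "x \<le> 1"
  shows "prob (X -` {1 - x<..} \<inter> space M) = x"
proof -
  have "emeasure M (X -` {1 - x<..} \<inter> space M) =
      (\<integral>\<^sup>+y. indicator {0<..<1} y * indicator {1 - x<..} y \<partial>lborel)"
    by (rule distributed_emeasure[OF X]) simp
  also have "\<dots> = (\<integral>\<^sup>+y. indicator {1 - x<..<1} y \<partial>lborel)"
    using x by (intro nn_integral_cong) (auto simp: indicator_def)
  also have "\<dots> = ennreal x" using x by simp
  finally show ?thesis using x by (simp add: emeasure_eq_measure)
qed

text \<open>The distribution fixes the coefficient only up to null sets, whereas the single-user
  bound asks for a coefficient below 1.\<close>

lemma (in prob_space) AE_uniform:
  assumes X: "distributed M lborel X (indicator {0<..<1::real})"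
  shows "AE \<omega> in M. 0 < X \<omega> \<and> X \<omega> < 1"
proof -
  have [measurable]: "X \<in> borel_measurable M" using distributed_measurable[OF X] by simp
  have "emeasure M (X -` (- {0<..<1}) \<inter> space M) =
      (\<integral>\<^sup>+y. indicator {0<..<1} y * indicator (- {0<..<1::real}) y \<partial>lborel)"
    by (rule distributed_emeasure[OF X]) simp
  also have "\<dots> = (\<integral>\<^sup>+y. 0 \<partial>(lborel :: real measure))"
    by (intro nn_integral_cong) (auto simp: indicator_def)
  finally show ?thesis
    by (intro AE_I[of _ _ "X -` (- {0<..<1}) \<inter> space M"]) auto
qed

text \<open>Each user is good with probability at least \<open>p = exp (- \<theta>) * x\<close>,
  independently of the others, so all fail with probability at most
  \<open>(1 - p) ^ K \<le> exp (- K * p)\<close>.\<close>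

lemma (in prob_space) prob_ex_good_user_ge:
  fixes U A :: "nat \<Rightarrow> 'a \<Rightarrow> real"
  assumes ind: "indep_vars (\<lambda>_. borel) (case_sum U A) (UNIV :: (nat + nat) set)"
    and U: "\<And>k. distributed M lborel (U k) (\<lambda>x. ennreal (rayleigh_density x))"
    and A: "\<And>k. distributed M lborel (A k) (indicator {0<..<1})"
    and \<theta>: "0 \<le> \<theta>" and x: "0 \<le> x" "x \<le> 1"
  shows "1 - exp (- (real K * exp (- \<theta>) * x)) \<le>
    prob {\<omega> \<in> space M. \<exists>k<K. \<theta> \<le> (U k \<omega>)\<^sup>2 \<and> 1 - x < A k \<omega>}"
proof (cases "K = 0")
  \<comment> \<open>The empty case is separate because an intersection over no users would be the
    universe instead of \<open>space M\<close>.\<close>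
  case True
  thus ?thesis by simp
next
  case False
  have Um [measurable]: "U k \<in> borel_measurable M" for k using distributed_measurable[OF U] by simp
  have Am [measurable]: "A k \<in> borel_measurable M" for k using distributed_measurable[OF A] by simp
  \<comment> \<open>Grouping gain and coefficient of each user into a block gives independent
    blocks; \<open>B k\<close> then expresses, as a set in the space of block \<open>k\<close>, that
    user \<open>k\<close> is not good.\<close>
  define J :: "nat \<Rightarrow> (nat + nat) set" where "J k = {Inl k, Inr k}" for k
  define Y where "Y k \<omega> = restrict (\<lambda>i. case_sum U A i \<omega>) (J k)" for k \<omega>
  have indY: "indep_vars (\<lambda>k. PiM (J k) (\<lambda>_. borel)) Y UNIV"
    unfolding Y_def [abs_def] using ind
    by (rule indep_vars_restrict) (auto simp: disjoint_family_on_def J_def)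
  define B where "B k = {f \<in> space (PiM (J k) (\<lambda>_. borel)). \<not> (\<theta> \<le> (f (Inl k))\<^sup>2 \<and> 1 - x < f (Inr k))}" for k
  have [measurable]: "(\<lambda>f. f (Inl k)) \<in> borel_measurable (PiM (J k) (\<lambda>_. borel :: real measure))"
    "(\<lambda>f. f (Inr k)) \<in> borel_measurable (PiM (J k) (\<lambda>_. borel :: real measure))" for k
    by (auto simp: J_def intro!: measurable_component_singleton)
  have Bm: "B k \<in> sets (PiM (J k) (\<lambda>_. borel))" for k
    unfolding B_def by measurable
  define G where "G k = {\<omega> \<in> space M. \<theta> \<le> (U k \<omega>)\<^sup>2 \<and> 1 - x < A k \<omega>}" for k
  have Gm [measurable]: "G k \<in> events" for k unfolding G_def by measurable
  have YB: "Y k -` B k \<inter> space M = space M - G k" for k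
    by (auto simp: Y_def B_def G_def J_def space_PiM)
  have G: "exp (- \<theta>) * x \<le> prob (G k)" for k
  proof -
    \<comment> \<open>Independence inside a single block factors the probability that user
      \<open>k\<close> is good.\<close>
    define S where "S i = (case i of Inl _ \<Rightarrow> {x. \<theta> \<le> x\<^sup>2} | Inr _ \<Rightarrow> {1 - x<..})" for i :: "nat + nat"
    have "prob (\<Inter>i\<in>J k. case_sum U A i -` S i \<inter> space M) =
        (\<Prod>i\<in>J k. prob (case_sum U A i -` S i \<inter> space M))"
      by (rule indep_varsD[OF ind]) (auto simp: J_def S_def split: sum.split)
    also have "\<dots> = prob (U k -` {x. \<theta> \<le> x\<^sup>2} \<inter> space M) * prob (A k -` {1 - x<..} \<inter> space M)"
      by (simp add: J_def S_def)
    also have "(\<Inter>i\<in>J k. case_sum U A i -` S i \<inter> space M) = G k"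
      by (auto simp: J_def S_def G_def)
    also have "exp (- \<theta>) * x \<le> prob (U k -` {x. \<theta> \<le> x\<^sup>2} \<inter> space M) * prob (A k -` {1 - x<..} \<inter> space M)"
      unfolding prob_uniform_gt[OF A x] using x by (intro mult_right_mono prob_rayleigh_ge[OF U \<theta>])
    finally show ?thesis .
  qed
  have "prob (space M - (\<Union>k<K. G k)) = prob (\<Inter>k\<in>{..<K}. Y k -` B k \<inter> space M)"
    unfolding YB using False by (intro arg_cong[of _ _ prob]) auto
  also have "\<dots> = (\<Prod>k\<in>{..<K}. prob (Y k -` B k \<inter> space M))"
    using False by (intro indep_varsD[OF indY] Bm) auto
  also have "\<dots> \<le> (\<Prod>k\<in>{..<K}. exp (- (exp (- \<theta>) * x)))"
  proof (intro prod_mono conjI)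
    fix k
    have "prob (Y k -` B k \<inter> space M) = 1 - prob (G k)"
      unfolding YB by (rule prob_compl) simp
    also have "\<dots> \<le> exp (- (exp (- \<theta>) * x))"
      using G[of k] exp_ge_add_one_self[of "- (exp (- \<theta>) * x)"] by linarith
    finally show "prob (Y k -` B k \<inter> space M) \<le> \<dots>" .
  qed simp
  also have "\<dots> = exp (- (real K * exp (- \<theta>) * x))"
    by (simp add: exp_of_nat_mult[symmetric] mult.assoc)
  finally have "1 - exp (- (real K * exp (- \<theta>) * x)) \<le> prob (\<Union>k<K. G k)"
    by (subst (asm) prob_compl) auto
  also have "(\<Union>k<K. G k) = {\<omega> \<in> space M. \<exists>k<K. \<theta> \<le> (U k \<omega>)\<^sup>2 \<and> 1 - x < A k \<omega>}"
    by (auto simp: G_def)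
  finally show ?thesis .
qed

text \<open>If some user is good, the selected one reports as well and its coefficient is at least
  as large, so the single-user bound \<open>C\<close> applies to it. Elsewhere the integrand is
  bounded below by 0.\<close>

lemma (in prob_space) throughput3_ge:
  fixes U A :: "nat \<Rightarrow> 'a \<Rightarrow> real"
  assumes ind: "indep_vars (\<lambda>_. borel) (case_sum U A) (UNIV :: (nat + nat) set)"
    and U: "\<And>k. distributed M lborel (U k) (\<lambda>x. ennreal (rayleigh_density x))"
    and A: "\<And>k. distributed M lborel (A k) (indicator {0<..<1})"
    and \<theta>: "0 \<le> \<theta>" and x: "0 \<le> x" "x \<le> 1"
    and C: "0 \<le> C" "\<And>u0 \<alpha>. \<theta> \<le> u0\<^sup>2 \<Longrightarrow> 1 - x < \<alpha> \<Longrightarrow> \<alpha> < 1 \<Longrightarrow>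
      \<exists>N\<ge>1. \<exists>R\<ge>0. C \<le> user_throughput P u0 \<alpha> N R"
  shows "ennreal (C * (1 - exp (- (real K * exp (- \<theta>) * x)))) \<le> throughput3 P M U A \<theta> K"
proof -
  define G where "G = {\<omega> \<in> space M. \<exists>k<K. \<theta> \<le> (U k \<omega>)\<^sup>2 \<and> 1 - x < A k \<omega>}"
  have [measurable]: "U k \<in> borel_measurable M" for k using distributed_measurable[OF U] by simp
  have [measurable]: "A k \<in> borel_measurable M" for k using distributed_measurable[OF A] by simp
  have Gm [measurable]: "G \<in> events" unfolding G_def by measurable
  have AE: "AE \<omega> in M. \<forall>k. 0 < A k \<omega> \<and> A k \<omega> < 1"
    unfolding AE_all_countable using AE_uniform[OF A] by blast
  have "ennreal (C * (1 - exp (- (real K * exp (- \<theta>) * x)))) \<le> ennreal (C * prob G)"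
    unfolding G_def using C(1) by (intro ennreal_leI mult_left_mono prob_ex_good_user_ge[OF ind U A \<theta> x])
  also have "\<dots> = (\<integral>\<^sup>+\<omega>. ennreal C * indicator G \<omega> \<partial>M)"
    using C(1) by (subst nn_integral_cmult_indicator) (auto simp: emeasure_eq_measure ennreal_mult')
  also have "\<dots> \<le> throughput3 P M U A \<theta> K"
    unfolding throughput3_def
  proof (rule nn_integral_mono_AE, use AE in eventually_elim)
    case (elim \<omega>)
    define S where "S = reporting_users U \<theta> K \<omega>"
    define j where "j = selected_user U A \<theta> K \<omega>"
    show ?case
    proof (cases "\<omega> \<in> G")
      case True
      then obtain k where k: "k < K" "\<theta> \<le> (U k \<omega>)\<^sup>2" "1 - x < A k \<omega>" by (auto simp: G_def)
      have S: "finite S" "k \<in> S" using k by (auto simp: S_def reporting_users_def)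
      have j: "j \<in> S" "A k \<omega> \<le> A j \<omega>"
        unfolding j_def selected_user_def S_def[symmetric] using S by (auto intro!: arg_max_on_finite)
      have "\<theta> \<le> (U j \<omega>)\<^sup>2" "1 - x < A j \<omega>" "A j \<omega> < 1"
        using j k elim by (auto simp: S_def reporting_users_def)
      from C(2)[OF this] obtain N R
        where NR: "1 \<le> N" "0 \<le> R" "C \<le> user_throughput P (U j \<omega>) (A j \<omega>) N R" by blast
      have "ennreal C \<le> ennreal (user_throughput P (U j \<omega>) (A j \<omega>) N R)"
        using NR by (intro ennreal_leI)
      also have "\<dots> \<le> (SUP N\<in>{1..}. SUP R\<in>{0..}. ennreal (user_throughput P (U j \<omega>) (A j \<omega>) N R))"
        using NR by (intro SUP_upper2[of N] SUP_upper2[of R]) auto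
      finally show ?thesis
        using True S unfolding j_def S_def by (auto simp: indicator_def)
    qed simp
  qed
  finally show ?thesis .
qed

section \<open>Asymptotic lower bound for Strategy III\<close>

theorem theorem4:
  fixes P :: real and \<Theta> a :: "nat \<Rightarrow> real"
    and M :: "'a measure" and U A :: "nat \<Rightarrow> 'a \<Rightarrow> real"
  assumes "0 < P"
    and "prob_space M"
    and "prob_space.indep_vars M (\<lambda>_. borel) (case_sum U A) (UNIV :: (nat + nat) set)"
    and "\<And>k. distributed M lborel (U k) (\<lambda>x. ennreal (rayleigh_density x))"
    and "\<And>k. distributed M lborel (A k) (indicator {0<..<1})"
    and "a \<in> o(\<lambda>K. ln (real K))"
    and "\<forall>\<^sub>F K in sequentially. ln (real K) - a K \<le> \<Theta> K"
    and "filterlim (\<lambda>K. ln (real K) - ln (ln (real K)) - \<Theta> K) at_top sequentially"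
  shows "\<exists>\<epsilon> \<in> o(\<lambda>_. 1 :: real). \<forall>\<^sub>F K in sequentially.
           ennreal (ln (P * ln (real K)) - \<epsilon> K) \<le> throughput3 P M U A (\<Theta> K) K"
proof -
  interpret prob_space M by fact
  define T where "T K = throughput3 P M U A (\<Theta> K) K" for K
  \<comment> \<open>A fixed loss \<open>c\<close> is handled first; a single vanishing
    \<open>\<epsilon>\<close> is extracted at the end. Half of \<open>c\<close> pays for the
    single-user bound, the other half for the event that no user is good.\<close>
  have lower: "\<forall>\<^sub>F K in sequentially. ennreal (ln (P * ln (real K)) - c) \<le> T K" if c: "0 < c" for c
  proof -
    obtain \<eta> where \<eta>: "0 < \<eta>" "\<eta> < 1" and ev:
      "\<forall>\<^sub>F L in at_top. \<forall>u0 \<alpha>. (1 - \<eta>) * L \<le> u0\<^sup>2 \<longrightarrow> 1 - 1 / sqrt L \<le> \<alpha> \<longrightarrow> 0 < \<alpha> \<longrightarrow> \<alpha> < 1 \<longrightarrow>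
       (\<exists>N\<ge>1. \<exists>R\<ge>0. ln (P * L) - c / 2 \<le> user_throughput P u0 \<alpha> N R)"
      using eventually_user_throughput_ge[OF \<open>0 < P\<close>, of "c / 2"] c by auto
    have lim: "filterlim (\<lambda>K. ln (real K)) at_top sequentially" by real_asymp
    have "((\<lambda>L. ln (P * L) * exp (- sqrt L)) \<longlongrightarrow> 0) at_top"
      using \<open>0 < P\<close> by real_asymp
    hence "\<forall>\<^sub>F L in at_top. ln (P * L) * exp (- sqrt L) < c / 2"
      using c by (intro order_tendstoD) auto
    moreover have "\<forall>\<^sub>F L in at_top. c / 2 \<le> ln (P * L)" using \<open>0 < P\<close> by real_asymp
    moreover have "\<forall>\<^sub>F L in at_top. (1::real) < L" by real_asymp
    moreover note ev
    ultimately have evL: "\<forall>\<^sub>F L in at_top. ln (P * L) * exp (- sqrt L) < c / 2 \<and> c / 2 \<le> ln (P * L) \<and> 1 < L \<and>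
      (\<forall>u0 \<alpha>. (1 - \<eta>) * L \<le> u0\<^sup>2 \<longrightarrow> 1 - 1 / sqrt L \<le> \<alpha> \<longrightarrow> 0 < \<alpha> \<longrightarrow> \<alpha> < 1 \<longrightarrow>
       (\<exists>N\<ge>1. \<exists>R\<ge>0. ln (P * L) - c / 2 \<le> user_throughput P u0 \<alpha> N R))"
      by eventually_elim auto
    \<comment> \<open>The upper bound on \<open>\<Theta>\<close> yields
      \<open>K * exp (- \<Theta> K) \<ge> L\<close>; the lower bound, with \<open>a K\<close> at
      most \<open>\<eta> * L\<close>, yields
      \<open>\<Theta> K \<ge> (1 - \<eta>) * L\<close>.\<close>
    have "\<forall>\<^sub>F K in sequentially. 0 \<le> ln (real K) - ln (ln (real K)) - \<Theta> K"
      using assms(8) unfolding filterlim_at_top by blast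
    moreover have "\<forall>\<^sub>F K in sequentially. norm (a K) \<le> \<eta> * norm (ln (real K))"
      using landau_o.smallD[OF assms(6) \<eta>(1)] .
    moreover note assms(7)
    moreover note eventually_compose_filterlim[OF evL lim]
    ultimately show ?thesis
    proof eventually_elim
      case (elim K)
      define L where "L = ln (real K)"
      define x where "x = 1 / sqrt L"
      have L: "1 < L" "ln (P * L) * exp (- sqrt L) < c / 2" "c / 2 \<le> ln (P * L)"
        using elim(4) by (auto simp: L_def)
      have x: "0 \<le> x" "x \<le> 1" using L by (auto simp: x_def)
      have "(1 - \<eta>) * L \<le> \<Theta> K"
        using elim(2,3) L by (simp add: L_def[symmetric] algebra_simps)
      moreover have "0 \<le> (1 - \<eta>) * L" using \<eta> L by simp
      ultimately have \<Theta>: "0 \<le> \<Theta> K" "(1 - \<eta>) * L \<le> \<Theta> K" by auto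
      define Q where "Q = exp (- (real K * exp (- \<Theta> K) * x))"
      have "ennreal ((ln (P * L) - c / 2) * (1 - Q)) \<le> T K"
        unfolding T_def Q_def
      proof (rule throughput3_ge[OF assms(3-5) \<Theta>(1) x])
        show "\<exists>N\<ge>1. \<exists>R\<ge>0. ln (P * L) - c / 2 \<le> user_throughput P u0 \<alpha> N R"
          if "\<Theta> K \<le> u0\<^sup>2" "1 - x < \<alpha>" "\<alpha> < 1" for u0 \<alpha>
        proof -
          have "(1 - \<eta>) * L \<le> u0\<^sup>2" "1 - 1 / sqrt L \<le> \<alpha>" "0 < \<alpha>"
            using that \<Theta> x by (simp_all add: x_def)
          thus ?thesis using elim(4) \<open>\<alpha> < 1\<close> unfolding L_def by blast
        qed
      qed (use L in simp)
      \<comment> \<open>The exponent \<open>K * exp (- \<Theta> K) * x\<close> is at least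
        \<open>L / sqrt L = sqrt L\<close>.\<close>
      moreover have "Q \<le> exp (- sqrt L)"
      proof -
        have K: "0 < real K" using L by (cases "K = 0") (auto simp: L_def)
        have "ln L \<le> ln (real K) - \<Theta> K" using elim(1) by (simp add: L_def)
        hence "exp (ln L) \<le> exp (ln (real K) - \<Theta> K)" by simp
        hence "L \<le> real K * exp (- \<Theta> K)" using L K by (simp add: exp_diff exp_minus field_simps)
        hence "L * x \<le> real K * exp (- \<Theta> K) * x" using x by (rule_tac mult_right_mono)
        moreover have "L * x = sqrt L" using L by (simp add: x_def real_div_sqrt)
        ultimately show ?thesis by (simp add: Q_def)
      qed
      hence "(ln (P * L) - c / 2) * Q \<le> ln (P * L) * exp (- sqrt L)"
        using L c by (intro mult_mono) (auto simp: Q_def)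
      hence "ln (P * L) - c \<le> (ln (P * L) - c / 2) * (1 - Q)"
        using L by (simp add: right_diff_distrib)
      ultimately show ?case
        unfolding L_def[symmetric] using ennreal_leI order_trans by blast
    qed
  qed
  \<comment> \<open>The positive part of the shortfall. An infinite throughput is set apart, since
    \<open>enn2real\<close> would send it to 0.\<close>
  define \<epsilon> where "\<epsilon> K = (if T K = \<top> then 0 else max 0 (ln (P * ln (real K)) - enn2real (T K)))" for K
  have "\<epsilon> \<in> o(\<lambda>_. 1)"
  proof (rule landau_o.smallI)
    fix c :: real assume c: "0 < c"
    show "\<forall>\<^sub>F K in sequentially. norm (\<epsilon> K) \<le> c * norm (1 :: real)"
      using lower[OF c]
    proof eventually_elim
      case (elim K)
      show ?case
      proof (cases "T K = \<top>")
        case False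
        have "ennreal (ln (P * ln (real K)) - c) \<le> ennreal (enn2real (T K))"
          using elim False by (simp add: less_top)
        \<comment> \<open>\<open>ennreal\<close> truncates negative reals to 0; in that case the
          inequality holds because \<open>enn2real\<close> is nonnegative.\<close>
        hence "ln (P * ln (real K)) - c \<le> enn2real (T K)"
          using enn2real_nonneg[of "T K"] by (auto simp: ennreal_le_iff2)
        thus ?thesis using False c by (auto simp: \<epsilon>_def)
      qed (use c in \<open>simp add: \<epsilon>_def\<close>)
    qed
  qed
  moreover have "ennreal (ln (P * ln (real K)) - \<epsilon> K) \<le> T K" for K
  proof (cases "T K = \<top>")
    case False
    have "ennreal (ln (P * ln (real K)) - \<epsilon> K) \<le> ennreal (enn2real (T K))"
      using False by (intro ennreal_leI) (auto simp: \<epsilon>_def)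
    also have "\<dots> = T K" using False by (intro ennreal_enn2real) (simp add: less_top)
    finally show ?thesis .
  qed simp
  ultimately show ?thesis
    unfolding T_def by (intro bexI[of _ \<epsilon>] always_eventually allI)
qed

end
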